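(* Let $\overline{\mathsf{R}}$ and $\overline{\Lambda}:\overline{\mathsf{R}}\to\mathbb{C}$ be as defined in the context. Then \[ \overline{\Lambda}\left(\overline{\mathsf{R}}\right)=\overline{\mathfrak{F}}\setminus\mathbb{Q}(i), \] where $\overline{\mathfrak{F}}$ is the closure of $\mathfrak{F}$ in $\mathbb{C}$.
   Context: For $z\in\mathbb{C}$, the nearest Gaussian integer is $[z]:=\lfloor \mathrm{Re}(z)+\tfrac12\rfloor+i\lfloor \mathrm{Im}(z)+\tfrac12\rfloor$. Let $\mathfrak{F}:=\{z\in\mathbb{C}:[z]=0\}=\{z: -\tfrac12\le \mathrm{Re}(z)<\tfrac12,\ -\tfrac12\le \mathrm{Im}(z)<\tfrac12\}$. The complex Gauss map $T:\mathfrak{F}\to\mathfrak{F}$ is $T(0)=0$ and $T(z)=z^{-1}-[z^{-1}]$ for $z\neq0$. For $z\in\mathfrak{F}\setminus\{0\}$ put $a_1(z)=[z^{-1}]$ and, when $T^{n-1}(z)\neq0$, $a_n(z)=a_1(T^{n-1}(z))$ (Hurwitz partial quotients). For $n\in\mathbb{N}$ and $(b_1,\dots,b_n)\in\mathbb{Z}[i]^n$, the cylinder is $\mathcal{C}_n(b_1,\dots,b_n):=\{z\in\mathfrak{F}: a_1(z)=b_1,\dots,a_n(z)=b_n\}$, and $\mathcal{C}^{\circ}_n(b_1,\dots,b_n)$ denotes its interior in $\mathbb{C}$. Define \[ \overline{\mathsf{R}}:=\{(a_n)_{n\ge1}\in\mathbb{Z}[i]^{\mathbb{N}}:\ \forall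 n\in\mathbb{N}\ \ \mathcal{C}^{\circ}_n(a_1,\dots,a_n)\neq\emptyset\}. \] For a sequence $(a_n)$ of Gaussian integers define $p_{-1}=1,p_{-2}=0,q_{-1}=0,q_{-2}=1$ and $p_n=a_np_{n-1}+p_{n-2}$, $q_n=a_nq_{n-1}+q_{n-2}$ for $n\ge0$ (with $a_0=0$), so that $p_n/q_n=0+\cfrac{1}{a_1+\cfrac{1}{\ddots+\cfrac{1}{a_n}}}$. For $\mathbf{a}=(a_n)\in\overline{\mathsf{R}}$, $\overline{\Lambda}(\mathbf{a}):=\lim_{n\to\infty}p_n/q_n$ (this limit exists). *)

theory Defs
  imports "HOL-Analysis.Analysis"
begin

definition gaussian_integers :: "complex set" where
  "gaussian_integers = {z. Re z \<in> \<int> \<and> Im z \<in> \<int>}"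

definition gaussian_rationals :: "complex set" where
  "gaussian_rationals = {z. Re z \<in> \<rat> \<and> Im z \<in> \<rat>}"

definition nearest_gaussian :: "complex \<Rightarrow> complex" where
  "nearest_gaussian z = Complex (of_int \<lfloor>Re z + 1/2\<rfloor>) (of_int \<lfloor>Im z + 1/2\<rfloor>)"

definition hurwitz_square :: "complex set" where
  "hurwitz_square = {z. nearest_gaussian z = 0}"

lemma hurwitz_square_eq:
  "hurwitz_square = {z. -1/2 \<le> Re z \<and> Re z < 1/2 \<and> -1/2 \<le> Im z \<and> Im z < 1/2}"
  by (auto simp: hurwitz_square_def nearest_gaussian_def complex_eq_iff floor_eq_iff)

definition gauss_map :: "complex \<Rightarrow> complex" where
  "gauss_map z = (if z = 0 then 0 else inverse z - nearest_gaussian (inverse z))"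

lemma gauss_map_in_hurwitz_square: "gauss_map z \<in> hurwitz_square"
proof -
  have "w - nearest_gaussian w \<in> hurwitz_square" for w
    unfolding hurwitz_square_eq nearest_gaussian_def mem_Collect_eq minus_complex.sel complex.sel
    by (intro conjI; linarith)
  moreover have "0 \<in> hurwitz_square"
    by (simp add: hurwitz_square_eq)
  ultimately show ?thesis
    by (simp add: gauss_map_def)
qed

text \<open>The partial quotient \<open>a\<^sub>n(z)\<close>, meaningful for \<open>n \<ge> 1\<close> and \<open>T\<^sup>n\<^sup>-\<^sup>1(z) \<noteq> 0\<close>.\<close>

definition hurwitz_pq :: "nat \<Rightarrow> complex \<Rightarrow> complex" where
  "hurwitz_pq n z = nearest_gaussian (inverse ((gauss_map ^^ (n - 1)) z))"

text \<open>
  Only \<open>b 1, \<dots>, b n\<close> matter. The condition that the iterates do not vanish says that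
  the partial quotients are defined; without it, \<open>inverse 0 = 0\<close> would create spurious
  partial quotients \<open>0\<close>.
\<close>

definition hurwitz_cylinder :: "nat \<Rightarrow> (nat \<Rightarrow> complex) \<Rightarrow> complex set" where
  "hurwitz_cylinder n b =
     {z \<in> hurwitz_square.
        \<forall>k\<in>{1..n}. (gauss_map ^^ (k - 1)) z \<noteq> 0 \<and> hurwitz_pq k z = b k}"

text \<open>
  A sequence \<open>(a\<^sub>n)\<close>, \<open>n \<ge> 1\<close>, is a function on \<open>nat\<close> that takes the conventional
  value \<open>a\<^sub>0 = 0\<close> at \<open>0\<close>.
\<close>

definition R_bar :: "(nat \<Rightarrow> complex) set" where
  "R_bar = {a. a 0 = 0 \<and> (\<forall>n\<ge>1. a n \<in> gaussian_integers) \<and>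
               (\<forall>n\<ge>1. interior (hurwitz_cylinder n a) \<noteq> {})}"

text \<open>The index is shifted by two: \<open>p\<^sub>n = cf_p a (n + 2)\<close> and \<open>q\<^sub>n = cf_q a (n + 2)\<close> for \<open>n \<ge> -2\<close>.\<close>

fun cf_p :: "(nat \<Rightarrow> complex) \<Rightarrow> nat \<Rightarrow> complex" where
  "cf_p a 0 = 0"
| "cf_p a (Suc 0) = 1"
| "cf_p a (Suc (Suc n)) = a n * cf_p a (Suc n) + cf_p a n"

fun cf_q :: "(nat \<Rightarrow> complex) \<Rightarrow> nat \<Rightarrow> complex" where
  "cf_q a 0 = 1"
| "cf_q a (Suc 0) = 0"
| "cf_q a (Suc (Suc n)) = a n * cf_q a (Suc n) + cf_q a n"

definition Lambda_bar :: "(nat \<Rightarrow> complex) \<Rightarrow> complex" where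
  "Lambda_bar a = lim (\<lambda>n. cf_p a (n + 2) / cf_q a (n + 2))"

end

theory Submission
  imports Defs
begin

text \<open>
  If \<open>w\<^sub>0 = z\<close> and \<open>w\<^sub>k\<^sub>+\<^sub>1 = 1/w\<^sub>k - a\<^sub>k\<^sub>+\<^sub>1\<close> stays in the closed square, then
  \<open>q\<^sub>n z - p\<^sub>n = \<plusminus> w\<^sub>0 \<cdots> w\<^sub>n\<close> is at most \<open>(3/4)\<^sup>n\<^sup>+\<^sup>1\<close> in modulus. As \<open>p\<^sub>n\<close> and \<open>q\<^sub>n\<close> are Gaussian
  integers with determinant \<open>\<plusminus>1\<close>, this forces \<open>q\<^sub>n \<noteq> 0\<close>, hence \<open>\<bar>q\<^sub>n\<bar> \<ge> 1\<close> and
  \<open>\<bar>z - p\<^sub>n/q\<^sub>n\<bar> \<le> (3/4)\<^sup>n\<^sup>+\<^sup>1\<close>; no monotonicity of \<open>\<bar>q\<^sub>n\<bar>\<close> is required. A limit with all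
  \<open>w\<^sub>n \<noteq> 0\<close> is irrational, because a rational one would make a fixed multiple of \<open>q\<^sub>n z - p\<^sub>n\<close> a
  nonzero Gaussian integer tending to zero. Conversely, an irrational \<open>z\<close> in the closure of
  the interior of a cylinder lies in the closure of the interior of one of its children: near
  \<open>z\<close> only finitely many children occur, and their interiors are dense. Iterating from the
  square itself yields a sequence whose cylinders shrink to \<open>z\<close>.
\<close>

section \<open>Gaussian integers and rationals\<close>

lemma gaussian_integers_simps [simp]:
  "0 \<in> gaussian_integers" "1 \<in> gaussian_integers" "nearest_gaussian z \<in> gaussian_integers"
  by (auto simp: gaussian_integers_def nearest_gaussian_def)

lemma gaussian_integers_closed:
  assumes "x \<in> gaussian_integers" "y \<in> gaussian_integers"
  shows "x + y \<in> gaussian_integers" "x - y \<in> gaussian_integers" "x * y \<in> gaussian_integers"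
  using assms by (auto simp: gaussian_integers_def)

lemma gaussian_integer_norm_less_one:
  assumes "x \<in> gaussian_integers" "norm x < 1"
  shows "x = 0"
proof -
  have "\<bar>Re x\<bar> < 1" "\<bar>Im x\<bar> < 1"
    using abs_Re_le_cmod[of x] abs_Im_le_cmod[of x] assms(2) by linarith+
  then show ?thesis
    using assms(1) by (auto simp: gaussian_integers_def complex_eq_iff elim!: Ints_cases)
qed

lemma finite_gaussian_integers_bounded: "finite {x \<in> gaussian_integers. norm x \<le> B}"
proof (rule finite_subset)
  let ?I = "{-\<lceil>B\<rceil>..\<lceil>B\<rceil>}"
  show "{x \<in> gaussian_integers. norm x \<le> B} \<subseteq> (\<lambda>(i, j). Complex (of_int i) (of_int j)) ` (?I \<times> ?I)"
  proof
    fix x assume x: "x \<in> {x \<in> gaussian_integers. norm x \<le> B}"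
    then obtain i j where ij: "Re x = of_int i" "Im x = of_int j"
      by (auto simp: gaussian_integers_def elim!: Ints_cases)
    have "\<bar>Re x\<bar> \<le> B" "\<bar>Im x\<bar> \<le> B"
      using abs_Re_le_cmod[of x] abs_Im_le_cmod[of x] x by auto
    then have "i \<in> ?I" "j \<in> ?I"
      unfolding ij by (simp_all; linarith)+
    then show "x \<in> (\<lambda>(i, j). Complex (of_int i) (of_int j)) ` (?I \<times> ?I)"
      using ij by (intro image_eqI[of _ _ "(i, j)"]) (auto simp: complex_eq_iff)
  qed
qed simp

lemma gaussian_rational_denominator:
  assumes "z \<in> gaussian_rationals"
  obtains v where "v \<in> gaussian_integers" "v \<noteq> 0" "v * z \<in> gaussian_integers"
proof -
  have "Re z \<in> \<rat>" "Im z \<in> \<rat>"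
    using assms by (simp_all add: gaussian_rationals_def)
  then obtain i j k l where ij: "j \<noteq> 0" "Re z = of_int i / of_int j"
    and kl: "l \<noteq> 0" "Im z = of_int k / of_int l"
    by (metis Rats_cases' less_irrefl)
  show ?thesis
  proof (rule that)
    show "of_int (j * l) \<in> gaussian_integers"
      by (auto simp: gaussian_integers_def)
    show "(of_int (j * l) :: complex) \<noteq> 0"
      using ij(1) kl(1) by simp
    have "of_int (j * l) * Re z = of_int (i * l)" "of_int (j * l) * Im z = of_int (j * k)"
      using ij kl by (simp_all add: field_simps)
    then have "of_int (j * l) * z = Complex (of_int (i * l)) (of_int (j * k))"
      by (simp add: complex_eq_iff)
    then show "of_int (j * l) * z \<in> gaussian_integers"
      by (simp add: gaussian_integers_def)
  qed
qed

lemma gaussian_integers_divide_rational: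
  assumes "x \<in> gaussian_integers" "y \<in> gaussian_integers"
  shows "x / y \<in> gaussian_rationals"
proof -
  have "Re x \<in> \<rat>" "Im x \<in> \<rat>" "Re y \<in> \<rat>" "Im y \<in> \<rat>"
    using assms Ints_subset_Rats by (auto simp: gaussian_integers_def)
  then show ?thesis
    by (simp add: gaussian_rationals_def Re_divide Im_divide)
qed

section \<open>The square\<close>

lemma hurwitz_square_between_boxes:
  "box (Complex (-1/2) (-1/2)) (Complex (1/2) (1/2)) \<subseteq> hurwitz_square"
  "hurwitz_square \<subseteq> cbox (Complex (-1/2) (-1/2)) (Complex (1/2) (1/2))"
  by (auto simp: hurwitz_square_eq in_cbox_complex_iff in_box_complex_iff)

lemma closure_hurwitz_square_box:
  "closure (box (Complex (-1/2) (-1/2)) (Complex (1/2) (1/2))) =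
    cbox (Complex (-1/2) (-1/2)) (Complex (1/2) (1/2))"
proof (rule closure_box)
  have "0 \<in> box (Complex (-1/2) (-1/2)) (Complex (1/2) (1/2))"
    by (simp add: in_box_complex_iff)
  then show "box (Complex (-1/2) (-1/2)) (Complex (1/2) (1/2)) \<noteq> {}"
    by blast
qed

text \<open>The half-open square lies between an open box and the closure of that box. This gives
  the start of the nested construction and makes the interiors of the translated unit squares dense
  in the plane.\<close>

lemma closure_hurwitz_square_subset:
  "closure hurwitz_square \<subseteq> closure (interior hurwitz_square)"
proof -
  have "box (Complex (-1/2) (-1/2)) (Complex (1/2) (1/2)) \<subseteq> interior hurwitz_square"
    by (rule interior_maximal[OF hurwitz_square_between_boxes(1) open_box])
  from closure_mono[OF this] closure_mono[OF hurwitz_square_between_boxes(2)] show ?thesis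
    unfolding closure_hurwitz_square_box closure_cbox by (rule order_trans[rotated])
qed

text \<open>A rational bound just above the exact value 1/sqrt 2; later only its being below 1
  matters.\<close>

lemma norm_hurwitz_square:
  assumes "z \<in> hurwitz_square"
  shows "norm z \<le> 3/4"
proof -
  have "\<bar>Re z\<bar> \<le> 1/2" "\<bar>Im z\<bar> \<le> 1/2"
    using assms by (auto simp: hurwitz_square_eq)
  then have "(Re z)\<^sup>2 \<le> (1/2)\<^sup>2" "(Im z)\<^sup>2 \<le> (1/2)\<^sup>2"
    by (simp_all only: abs_le_square_iff[symmetric] abs_divide abs_one abs_numeral)
  then have "(Re z)\<^sup>2 + (Im z)\<^sup>2 \<le> (3/4)\<^sup>2"
    by (simp add: power2_eq_square)
  then show ?thesis
    unfolding cmod_def by (rule real_le_lsqrt[rotated]) simp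
qed

lemma diff_nearest_gaussian: "w - nearest_gaussian w \<in> hurwitz_square"
  unfolding hurwitz_square_eq nearest_gaussian_def mem_Collect_eq minus_complex.sel complex.sel
  by (intro conjI; linarith)

lemma nearest_gaussian_unique:
  assumes "c \<in> gaussian_integers" "w - c \<in> hurwitz_square"
  shows "nearest_gaussian w = c"
proof -
  obtain i j where "Re c = of_int i" "Im c = of_int j"
    using assms(1) by (auto simp: gaussian_integers_def elim!: Ints_cases)
  then show ?thesis
    using assms(2) by (auto simp: hurwitz_square_eq nearest_gaussian_def complex_eq_iff floor_eq_iff)
qed

section \<open>Convergents\<close>

lemma cf_gaussian_integers:
  assumes "\<And>k. a k \<in> gaussian_integers"
  shows "cf_p a n \<in> gaussian_integers" "cf_q a n \<in> gaussian_integers"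
  using assms by (induction a n rule: cf_p.induct) (auto intro!: gaussian_integers_closed)

lemma cf_determinant: "cf_p a (Suc k) * cf_q a k - cf_p a k * cf_q a (Suc k) = (-1) ^ k"
proof (induction k)
  case (Suc k)
  have "cf_p a (Suc (Suc k)) * cf_q a (Suc k) - cf_p a (Suc k) * cf_q a (Suc (Suc k)) =
      - (cf_p a (Suc k) * cf_q a k - cf_p a k * cf_q a (Suc k))"
    by (simp add: algebra_simps)
  then show ?case
    using Suc by simp
qed simp

lemma cf_p_q_not_both_zero: "cf_p a k \<noteq> 0 \<or> cf_q a k \<noteq> 0"
  using cf_determinant[of a k] by (metis diff_zero mult_zero_left mult_zero_right power_not_zero
      neg_equal_0_iff_equal zero_neq_one)

text \<open>With the shifted index this is q_n z - p_n at \<open>k = n + 2\<close>, so the values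
  start with z and -1. The linear form makes sense before q_n is known to be nonzero.\<close>

definition cf_error :: "(nat \<Rightarrow> complex) \<Rightarrow> complex \<Rightarrow> nat \<Rightarrow> complex" where
  "cf_error a z k = cf_q a k * z - cf_p a k"

text \<open>The errors obey the recurrence of p and q; replacing the digit by
  \<open>inverse (w k) - w (Suc k)\<close> makes it telescope. The orbit \<open>w\<close> is
  abstract because it will be either a \<open>gauss_map\<close> orbit or a limit of such
  orbits.\<close>

lemma cf_error_rec:
  assumes "a 0 = 0"
    and "\<And>k. k < n \<Longrightarrow> w k \<noteq> 0 \<and> w (Suc k) = inverse (w k) - a (Suc k)"
    and "k \<le> n"
  shows "cf_error a (w 0) (Suc (Suc k)) = - w k * cf_error a (w 0) (Suc k)"
  using assms(3)
proof (induction k)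
  case 0
  then show ?case
    by (simp add: cf_error_def assms(1))
next
  case (Suc k)
  let ?E = "cf_error a (w 0)"
  have w: "w k \<noteq> 0" "w (Suc k) = inverse (w k) - a (Suc k)"
    using assms(2)[of k] Suc.prems by auto
  have "?E (Suc (Suc (Suc k))) = a (Suc k) * ?E (Suc (Suc k)) + ?E (Suc k)"
    by (simp add: cf_error_def algebra_simps)
  also have "a (Suc k) = inverse (w k) - w (Suc k)"
    using w(2) by simp
  also have "(inverse (w k) - w (Suc k)) * ?E (Suc (Suc k)) + ?E (Suc k) =
      - w (Suc k) * ?E (Suc (Suc k)) + (inverse (w k) * ?E (Suc (Suc k)) + ?E (Suc k))"
    by (simp add: algebra_simps)
  also have "inverse (w k) * ?E (Suc (Suc k)) + ?E (Suc k) = 0"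
    using Suc w(1) by simp
  finally show ?case
    by simp
qed

lemma norm_cf_error_le:
  assumes "a 0 = 0"
    and "\<And>k. k < n \<Longrightarrow> w k \<noteq> 0 \<and> w (Suc k) = inverse (w k) - a (Suc k)"
    and "\<And>k. k \<le> n \<Longrightarrow> norm (w k) \<le> 3/4"
    and "k \<le> Suc n"
  shows "norm (cf_error a (w 0) (Suc k)) \<le> (3/4) ^ k"
  using assms(4)
proof (induction k)
  case 0
  then show ?case
    by (simp add: cf_error_def)
next
  case (Suc k)
  then have "norm (cf_error a (w 0) (Suc (Suc k))) = norm (w k) * norm (cf_error a (w 0) (Suc k))"
    using cf_error_rec[of a n w k, OF assms(1,2)] by (simp add: norm_mult)
  also have "\<dots> \<le> 3/4 * (3/4) ^ k"
    using Suc assms(3)[of k] by (intro mult_mono) auto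
  finally show ?case
    by simp
qed

lemma cf_error_nonzero:
  assumes "a 0 = 0"
    and "\<And>k. k < n \<Longrightarrow> w k \<noteq> 0 \<and> w (Suc k) = inverse (w k) - a (Suc k)"
    and "k \<le> n"
  shows "cf_error a (w 0) (Suc k) \<noteq> 0"
  using assms(3)
proof (induction k)
  case 0
  then show ?case
    by (simp add: cf_error_def)
next
  case (Suc k)
  then show ?case
    using cf_error_rec[of a n w k, OF assms(1,2)] assms(2)[of k] by simp
qed

lemma convergent_bound:
  assumes "a 0 = 0" "\<And>k. a k \<in> gaussian_integers"
    and "\<And>k. k < n \<Longrightarrow> w k \<noteq> 0 \<and> w (Suc k) = inverse (w k) - a (Suc k)"
    and "\<And>k. k \<le> n \<Longrightarrow> norm (w k) \<le> 3/4"
  shows "norm (w 0 - cf_p a (n + 2) / cf_q a (n + 2)) \<le> (3/4) ^ n"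
proof -
  let ?p = "cf_p a (n + 2)" and ?q = "cf_q a (n + 2)"
  have error: "norm (?q * w 0 - ?p) \<le> (3/4) ^ Suc n"
    using norm_cf_error_le[OF assms(1,3,4), of n "Suc n"] by (simp add: cf_error_def)
  have small: "(3/4 :: real) ^ Suc n < 1"
    by (rule power_Suc_less_one) auto
  have q: "?q \<noteq> 0"
  proof
    \<comment> \<open>The error is then \<open>- ?p\<close>, so \<open>?p\<close> vanishes too,
      against the determinant.\<close>
    assume "?q = 0"
    then have "norm ?p < 1"
      using error small by (simp only: mult_zero_left diff_0 norm_minus_cancel)
    then have "?p = 0"
      using cf_gaussian_integers(1)[OF assms(2)] by (intro gaussian_integer_norm_less_one)
    then show False
      using \<open>?q = 0\<close> cf_p_q_not_both_zero[of a "n + 2"] by simp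
  qed
  then have q1: "norm ?q \<ge> 1"
    using gaussian_integer_norm_less_one[OF cf_gaussian_integers(2)[OF assms(2)]] by (meson not_le)
  have "w 0 - ?p / ?q = (?q * w 0 - ?p) / ?q"
    using q by (simp add: field_simps)
  then have "norm (w 0 - ?p / ?q) = norm (?q * w 0 - ?p) / norm ?q"
    by (simp only: norm_divide)
  also have "\<dots> \<le> norm (?q * w 0 - ?p) / 1"
    using q1 by (intro divide_left_mono) auto
  also have "\<dots> \<le> (3/4) ^ Suc n"
    using error by simp
  also have "\<dots> \<le> (3/4) ^ n"
    by simp
  finally show ?thesis .
qed

lemma infinite_expansion_irrational:
  assumes "a 0 = 0" "\<And>k. a k \<in> gaussian_integers"
    and w: "\<And>k. w k \<noteq> 0 \<and> w (Suc k) = inverse (w k) - a (Suc k)"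
    and "\<And>k. norm (w k) \<le> 3/4"
  shows "w 0 \<notin> gaussian_rationals"
proof
  assume "w 0 \<in> gaussian_rationals"
  then obtain v where v: "v \<in> gaussian_integers" "v \<noteq> 0" "v * w 0 \<in> gaussian_integers"
    by (rule gaussian_rational_denominator)
  obtain n where n: "(3/4 :: real) ^ n < 1 / norm v"
    using real_arch_pow_inv[of "1 / norm v" "3/4"] v(2) by auto
  let ?x = "v * cf_error a (w 0) (Suc n)"
  have "?x = cf_q a (Suc n) * (v * w 0) - v * cf_p a (Suc n)"
    by (simp add: cf_error_def algebra_simps)
  then have "?x \<in> gaussian_integers"
    using v cf_gaussian_integers[OF assms(2)] by (simp add: gaussian_integers_closed)
  moreover have "norm ?x < 1"
  proof -
    have "norm ?x \<le> norm v * (3/4) ^ n"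
      using norm_cf_error_le[OF assms(1) w assms(4), of n n] by (simp add: norm_mult mult_left_mono)
    also have "\<dots> < 1"
      using n v(2) by (simp add: field_simps)
    finally show ?thesis .
  qed
  ultimately have "?x = 0"
    by (rule gaussian_integer_norm_less_one)
  then show False
    using cf_error_nonzero[OF assms(1) w order_refl, of n] v(2) by simp
qed

section \<open>Cylinders\<close>

lemma gauss_map_iterate_in_hurwitz_square:
  "z \<in> hurwitz_square \<Longrightarrow> (gauss_map ^^ k) z \<in> hurwitz_square"
  by (cases k) (auto simp: gauss_map_in_hurwitz_square)

lemma hurwitz_cylinder_0: "hurwitz_cylinder 0 b = hurwitz_square"
  by (simp add: hurwitz_cylinder_def)

lemma hurwitz_cylinder_antimono: "m \<le> n \<Longrightarrow> hurwitz_cylinder n b \<subseteq> hurwitz_cylinder m b"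
  by (auto simp: hurwitz_cylinder_def)

lemma hurwitz_cylinder_cong:
  "(\<And>k. 1 \<le> k \<Longrightarrow> k \<le> n \<Longrightarrow> b k = c k) \<Longrightarrow> hurwitz_cylinder n b = hurwitz_cylinder n c"
  by (auto simp: hurwitz_cylinder_def)

lemma hurwitz_cylinder_Suc:
  "hurwitz_cylinder (Suc n) b =
    {z \<in> hurwitz_cylinder n b. (gauss_map ^^ n) z \<noteq> 0 \<and>
      nearest_gaussian (inverse ((gauss_map ^^ n) z)) = b (Suc n)}"
proof -
  have "{1..Suc n} = insert (Suc n) {1..n}"
    by auto
  then show ?thesis
    by (auto simp: hurwitz_cylinder_def hurwitz_pq_def)
qed

lemma hurwitz_cylinder_iterates:
  assumes "z \<in> hurwitz_cylinder n a"
  shows "k < n \<Longrightarrow> (gauss_map ^^ k) z \<noteq> 0 \<and>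
      (gauss_map ^^ Suc k) z = inverse ((gauss_map ^^ k) z) - a (Suc k)"
    and "norm ((gauss_map ^^ k) z) \<le> 3/4"
proof -
  assume "k < n"
  then have "Suc k \<in> {1..n}"
    by auto
  then have "(gauss_map ^^ (Suc k - 1)) z \<noteq> 0 \<and> hurwitz_pq (Suc k) z = a (Suc k)"
    using assms unfolding hurwitz_cylinder_def by blast
  then show "(gauss_map ^^ k) z \<noteq> 0 \<and>
      (gauss_map ^^ Suc k) z = inverse ((gauss_map ^^ k) z) - a (Suc k)"
    by (auto simp: hurwitz_pq_def gauss_map_def)
next
  show "norm ((gauss_map ^^ k) z) \<le> 3/4"
    using assms by (intro norm_hurwitz_square gauss_map_iterate_in_hurwitz_square)
      (simp add: hurwitz_cylinder_def)
qed

section \<open>Convergence and irrationality of the limit\<close>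

lemma R_bar_gaussian_integers:
  assumes "a \<in> R_bar"
  shows "a 0 = 0" "a k \<in> gaussian_integers"
  using assms by (auto simp: R_bar_def) (cases k; auto)

text \<open>Any choice of points in the cylinders follows the convergents. Proving that the latter
  form a Cauchy sequence is what gives \<open>lim\<close> in \<open>Lambda_bar\<close> a
  meaning.\<close>

lemma hurwitz_cylinder_points_tendsto:
  assumes "a \<in> R_bar" and s: "\<And>n. s n \<in> hurwitz_cylinder n a"
  shows "s \<longlonglongrightarrow> Lambda_bar a"
proof -
  define c where "c = (\<lambda>n. cf_p a (n + 2) / cf_q a (n + 2))"
  have bound: "norm (s m - c k) \<le> (3/4) ^ k" if "k \<le> m" for k m
  proof -
    have "s m \<in> hurwitz_cylinder k a"
      using s hurwitz_cylinder_antimono[OF that] by blast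
    from convergent_bound[of a k "\<lambda>j. (gauss_map ^^ j) (s m)",
        OF R_bar_gaussian_integers[OF assms(1)] hurwitz_cylinder_iterates[OF this]]
    show ?thesis
      by (simp add: c_def)
  qed
  have null: "(\<lambda>k. (3/4 :: real) ^ k) \<longlonglongrightarrow> 0"
    by (rule LIMSEQ_realpow_zero) auto
  have "Cauchy c"
  proof (rule CauchyI)
    fix e :: real
    assume "e > 0"
    then have "\<forall>\<^sub>F k in sequentially. (3/4 :: real) ^ k < e / 4"
      using order_tendstoD(2)[OF null, of "e / 4"] by simp
    then obtain N where N: "(3/4 :: real) ^ N < e / 4"
      by (auto simp: eventually_sequentially)
    have close: "norm (c m - c N) < e / 2" if "m \<ge> N" for m
    proof -
      have "(3/4 :: real) ^ m \<le> (3/4) ^ N"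
        using that by (simp add: power_decreasing)
      \<comment> \<open>The point \<open>s m\<close> lies in the cylinders of both orders m and N,
        so it is close to both convergents.\<close>
      moreover have "norm (c m - c N) \<le> norm (s m - c N) + norm (s m - c m)"
        using norm_triangle_ineq4[of "s m - c N" "s m - c m"] by simp
      ultimately show ?thesis
        using bound[OF that] bound[of m m] N by linarith
    qed
    have "norm (c m - c n) < e" if "m \<ge> N" "n \<ge> N" for m n
      using norm_triangle_ineq4[of "c m - c N" "c n - c N"] close[OF that(1)] close[OF that(2)]
      by simp
    then show "\<exists>M. \<forall>m\<ge>M. \<forall>n\<ge>M. norm (c m - c n) < e"
      by blast
  qed
  then have c: "c \<longlonglongrightarrow> Lambda_bar a"
    by (simp add: Lambda_bar_def c_def Cauchy_convergent_iff convergent_LIMSEQ_iff)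
  have "(\<lambda>n. s n - c n) \<longlonglongrightarrow> 0"
    by (rule Lim_null_comparison[OF _ null]) (simp add: bound)
  from tendsto_add[OF this c] show ?thesis
    by simp
qed

lemma Lambda_bar_irrational:
  assumes "a \<in> R_bar" and s: "\<And>n. s n \<in> hurwitz_cylinder n a"
  shows "Lambda_bar a \<notin> gaussian_rationals"
proof -
  \<comment> \<open>The orbit is driven by the digits \<open>a\<close>, not by
    \<open>gauss_map\<close>: the limit may lie on the boundary of the cylinders, where its own
    partial quotients may differ from \<open>a\<close>.\<close>
  define w where "w = rec_nat (Lambda_bar a) (\<lambda>n x. inverse x - a (Suc n))"
  have w_Suc: "w (Suc n) = inverse (w n) - a (Suc n)" for n
    by (simp add: w_def)
  have s_iter: "(gauss_map ^^ n) (s m) \<noteq> 0 \<and>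
      (gauss_map ^^ Suc n) (s m) = inverse ((gauss_map ^^ n) (s m)) - a (Suc n)" if "n < m" for n m
    using hurwitz_cylinder_iterates(1)[OF s that] .
  have s_norm: "norm ((gauss_map ^^ n) (s m)) \<le> 3/4" for n m
    using hurwitz_cylinder_iterates(2)[OF s] .
  \<comment> \<open>The reciprocals of the approximating iterates are bounded by \<open>B\<close>,
    which keeps these iterates away from 0. Convergence is assumed here so that the induction below
    can call on this at each stage.\<close>
  have limit_nonzero: "w n \<noteq> 0" if lim: "(\<lambda>m. (gauss_map ^^ n) (s m)) \<longlonglongrightarrow> w n" for n
  proof -
    define B where "B = norm (a (Suc n)) + 3/4"
    have "B > 0"
      by (simp add: B_def add_nonneg_pos)
    have "norm ((gauss_map ^^ n) (s m)) \<ge> 1 / B" if "m \<ge> Suc n" for m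
    proof -
      let ?t = "(gauss_map ^^ n) (s m)"
      have t: "?t \<noteq> 0" "inverse ?t = (gauss_map ^^ Suc n) (s m) + a (Suc n)"
        using s_iter[of n m] that by auto
      then have "norm (inverse ?t) \<le> B"
        using norm_triangle_ineq[of "(gauss_map ^^ Suc n) (s m)" "a (Suc n)"]
          s_norm[of "Suc n" m] unfolding t(2) B_def by linarith
      then show ?thesis
        using t(1) \<open>B > 0\<close> by (simp add: norm_divide field_simps)
    qed
    then have "norm (w n) \<ge> 1 / B"
      using tendsto_lowerbound[OF tendsto_norm[OF lim], of "1 / B"] eventually_sequentially by auto
    then show ?thesis
      using \<open>B > 0\<close> by (auto simp: not_le)
  qed
  have lim: "(\<lambda>m. (gauss_map ^^ n) (s m)) \<longlonglongrightarrow> w n" for n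
  proof (induction n)
    case 0
    then show ?case
      using hurwitz_cylinder_points_tendsto[OF assms] by (simp add: w_def)
  next
    case (Suc n)
    have "(\<lambda>m. inverse ((gauss_map ^^ n) (s m)) - a (Suc n)) \<longlonglongrightarrow> w (Suc n)"
      unfolding w_Suc by (intro tendsto_intros Suc limit_nonzero)
    moreover have "\<forall>\<^sub>F m in sequentially.
        inverse ((gauss_map ^^ n) (s m)) - a (Suc n) = (gauss_map ^^ Suc n) (s m)"
      using eventually_gt_at_top[of n] by eventually_elim (use s_iter in simp)
    ultimately show ?case
      by (rule Lim_transform_eventually)
  qed
  have "norm (w n) \<le> 3/4" for n
    using tendsto_upperbound[OF tendsto_norm[OF lim[of n]], of "3/4"] s_norm by simp
  then have "w 0 \<notin> gaussian_rationals"
    using infinite_expansion_irrational[of a w] R_bar_gaussian_integers[OF assms(1)]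
      limit_nonzero[OF lim] w_Suc by blast
  then show ?thesis
    by (simp add: w_def)
qed

section \<open>Reaching every irrational point of the closed square\<close>

lemma cf_error_irrational_nonzero:
  assumes "\<And>k. a k \<in> gaussian_integers" "z \<notin> gaussian_rationals"
  shows "cf_error a z k \<noteq> 0"
proof
  assume "cf_error a z k = 0"
  then have eq: "cf_q a k * z = cf_p a k"
    by (simp add: cf_error_def)
  then have "cf_q a k \<noteq> 0"
    using cf_p_q_not_both_zero[of a k] by auto
  then have "z = cf_p a k / cf_q a k"
    using eq by (simp add: field_simps)
  then show False
    using gaussian_integers_divide_rational[OF cf_gaussian_integers[OF assms(1)]] assms(2) by simp
qed

text \<open>The quotient of consecutive errors is a Moebius transformation of the point, with
  determinant 1 or -1.\<close>

lemma cf_error_quotient_inj: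
  assumes "cf_error a u (Suc k) \<noteq> 0" "cf_error a v (Suc k) \<noteq> 0"
    and "cf_error a u k / cf_error a u (Suc k) = cf_error a v k / cf_error a v (Suc k)"
  shows "u = v"
proof -
  have "cf_error a u k * cf_error a v (Suc k) - cf_error a v k * cf_error a u (Suc k) = 0"
    using assms by (simp add: field_simps)
  also have "cf_error a u k * cf_error a v (Suc k) - cf_error a v k * cf_error a u (Suc k) =
      (cf_p a (Suc k) * cf_q a k - cf_p a k * cf_q a (Suc k)) * (v - u)"
    by (simp add: cf_error_def algebra_simps)
  finally show ?thesis
    by (simp add: cf_determinant)
qed

text \<open>Irrationality ensures that the Moebius map \<open>g\<close> has no pole at
  \<open>z\<close>. Near \<open>z\<close> it is an open map, so density of the interiors of the
  translated squares pulls back to density of the interiors of the children.\<close>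

lemma irrational_in_closure_of_child:
  assumes b: "b 0 = 0" "\<And>k. b k \<in> gaussian_integers"
    and z: "z \<notin> gaussian_rationals" "z \<in> closure (interior (hurwitz_cylinder n b))"
  obtains c where "c \<in> gaussian_integers"
    "z \<in> closure (interior (hurwitz_cylinder (Suc n) (b(Suc n := c))))"
proof -
  let ?U = "interior (hurwitz_cylinder n b)"
  \<comment> \<open>On the cylinder, \<open>g\<close> is \<open>1 / T\<^sup>n\<close>, but unlike that it is continuous near \<open>z\<close>.\<close>
  define g where "g u = - (cf_error b u (Suc n) / cf_error b u (Suc (Suc n)))" for u
  have cont_error: "continuous_on A (\<lambda>u. cf_error b u k)" for A k
    unfolding cf_error_def by (intro continuous_intros)
  define N where "N = {u. cf_error b u (Suc (Suc n)) \<noteq> 0}"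
  have "open N"
    unfolding N_def by (intro open_Collect_neq cont_error continuous_on_const)
  have cont_g: "continuous_on N g"
    unfolding g_def by (intro continuous_intros cont_error) (auto simp: N_def)
  have inj_g: "inj_on g N"
    by (rule inj_onI) (auto simp: g_def N_def intro: cf_error_quotient_inj)
  have "z \<in> N"
    using cf_error_irrational_nonzero[OF b(2) z(1)] by (simp add: N_def)
  define B where "B = norm (g z) + 1"
  define W where "W = N \<inter> g -` ball 0 B"
  have "open W"
    unfolding W_def by (rule continuous_open_preimage[OF cont_g \<open>open N\<close> open_ball])
  have "z \<in> W"
    using \<open>z \<in> N\<close> by (simp add: W_def B_def)
  have iterate: "(gauss_map ^^ n) u \<noteq> 0 \<and> inverse ((gauss_map ^^ n) u) = g u"
    if "u \<in> hurwitz_cylinder n b" "u \<in> N" for u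
  proof -
    have rec: "cf_error b u (Suc (Suc n)) = - (gauss_map ^^ n) u * cf_error b u (Suc n)"
      using cf_error_rec[of b n "\<lambda>k. (gauss_map ^^ k) u" n, OF b(1)]
        hurwitz_cylinder_iterates(1)[OF that(1)] by simp
    moreover have "cf_error b u (Suc (Suc n)) \<noteq> 0"
      using that(2) by (simp add: N_def)
    ultimately show ?thesis
      by (auto simp: g_def field_simps)
  qed
  \<comment> \<open>The nearest Gaussian integer to a point of \<open>ball 0 B\<close> has modulus
    at most B + 3/4, so \<open>S\<close> contains every digit that can occur on
    \<open>W\<close>.\<close>
  define S where "S = {c \<in> gaussian_integers. norm c \<le> B + 3/4}"
  have "finite S"
    unfolding S_def by (rule finite_gaussian_integers_bounded)
  \<comment> \<open>An open piece of the child with digit \<open>c\<close>: only points that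
    \<open>g\<close> sends to the interior of the unit square around \<open>c\<close> are
    kept.\<close>
  define V where "V c = ?U \<inter> (W \<inter> g -` ((+) c ` interior hurwitz_square))" for c
  have open_V: "open (V c)" for c
  proof -
    have "continuous_on W g"
      using cont_g by (rule continuous_on_subset) (auto simp: W_def)
    then show ?thesis
      unfolding V_def using \<open>open W\<close>
      by (intro open_Int open_interior continuous_open_preimage open_translation)
  qed
  have V_child: "V c \<subseteq> hurwitz_cylinder (Suc n) (b(Suc n := c))" if "c \<in> gaussian_integers" for c
  proof
    fix u assume u: "u \<in> V c"
    then have mem: "u \<in> hurwitz_cylinder n b" "u \<in> N"
      using interior_subset by (auto simp: V_def W_def)
    have "g u - c \<in> hurwitz_square"
      using u interior_subset[of hurwitz_square] by (auto simp: V_def)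
    then have "nearest_gaussian (g u) = c"
      by (rule nearest_gaussian_unique[OF that])
    moreover have "hurwitz_cylinder n (b(Suc n := c)) = hurwitz_cylinder n b"
      by (rule hurwitz_cylinder_cong) auto
    ultimately show "u \<in> hurwitz_cylinder (Suc n) (b(Suc n := c))"
      using mem iterate[OF mem] by (simp add: hurwitz_cylinder_Suc)
  qed
  have "z \<in> closure (\<Union>c\<in>S. V c)"
    unfolding closure_iff_nhds_not_empty
  proof (intro allI impI)
    fix A X :: "complex set"
    assume X: "X \<subseteq> A" "open X" "z \<in> X"
    define Y where "Y = X \<inter> W \<inter> ?U"
    have "open (X \<inter> W)" "z \<in> X \<inter> W"
      using X \<open>open W\<close> \<open>z \<in> W\<close> by auto
    then have "X \<inter> W \<inter> ?U \<noteq> {}"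
      using z(2) open_Int_closure_eq_empty[of "X \<inter> W" ?U] by blast
    then obtain u where u: "u \<in> Y"
      by (auto simp: Y_def)
    have "Y \<subseteq> N"
      by (auto simp: Y_def W_def)
    have "open Y"
      unfolding Y_def using X \<open>open W\<close> by auto
    \<comment> \<open>The point \<open>g u\<close> may sit on the edge of its square. Openness of
      the image lets \<open>u\<close> be exchanged for a nearby \<open>u'\<close> whose image is
      interior.\<close>
    then have "open (g ` Y)"
      using cont_g inj_g \<open>Y \<subseteq> N\<close>
      by (intro invariance_of_domain) (auto intro: continuous_on_subset inj_on_subset)
    define c where "c = nearest_gaussian (g u)"
    have gu: "g u - c \<in> hurwitz_square"
      unfolding c_def by (rule diff_nearest_gaussian)
    have "norm c \<le> norm (g u) + norm (g u - c)"
      using norm_triangle_ineq4[of "g u" "g u - c"] by simp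
    also have "\<dots> \<le> B + 3/4"
      using u norm_hurwitz_square[OF gu] by (intro add_mono) (auto simp: Y_def W_def)
    finally have "c \<in> S"
      by (simp add: S_def c_def)
    have "g u \<in> (+) c ` closure (interior hurwitz_square)"
      using gu closure_hurwitz_square_subset closure_subset
      by (intro image_eqI[of _ _ "g u - c"]) auto
    then have "g u \<in> closure ((+) c ` interior hurwitz_square)"
      by (simp add: closure_translation)
    then have "g ` Y \<inter> (+) c ` interior hurwitz_square \<noteq> {}"
      using \<open>open (g ` Y)\<close> u open_Int_closure_eq_empty[of "g ` Y"] by blast
    then obtain u' where "u' \<in> Y" "g u' \<in> (+) c ` interior hurwitz_square"
      by blast
    then have "u' \<in> V c" "u' \<in> A"
      using X(1) by (auto simp: V_def Y_def)
    then show "(\<Union>c\<in>S. V c) \<inter> A \<noteq> {}"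
      using \<open>c \<in> S\<close> by blast
  qed
  \<comment> \<open>Finiteness of \<open>S\<close> makes the union of closures closed, so a single
    digit serves \<open>z\<close>.\<close>
  moreover have "closure (\<Union>c\<in>S. V c) \<subseteq> (\<Union>c\<in>S. closure (V c))"
    using \<open>finite S\<close> by (intro closure_minimal closed_UN) (auto intro: closure_subset[THEN subsetD])
  ultimately obtain c where c: "c \<in> S" "z \<in> closure (V c)"
    by blast
  then have "V c \<subseteq> interior (hurwitz_cylinder (Suc n) (b(Suc n := c)))"
    using open_V V_child by (intro interior_maximal) (auto simp: S_def)
  from closure_mono[OF this] show ?thesis
    using c that[of c] by (auto simp: S_def)
qed

text \<open>Dependent choice picks whole sequences and records that stage n + 1 alters at most one
  entry. Entry k is thus frozen from stage k on, and the diagonal agrees with \<open>f n\<close> up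
  to index n.\<close>

lemma irrational_in_nested_closures:
  assumes "z \<in> closure hurwitz_square" "z \<notin> gaussian_rationals"
  obtains a where "a 0 = 0" "\<And>k. a k \<in> gaussian_integers"
    "\<And>n. z \<in> closure (interior (hurwitz_cylinder n a))"
proof -
  let ?P = "\<lambda>n b. b 0 = 0 \<and> (\<forall>k. b k \<in> gaussian_integers) \<and>
      z \<in> closure (interior (hurwitz_cylinder n b))"
  have "\<exists>f. \<forall>n. ?P n (f n) \<and> (\<exists>c. f (Suc n) = (f n)(Suc n := c))"
  proof (rule dependent_nat_choice)
    show "\<exists>b. ?P 0 b"
      using assms(1) closure_hurwitz_square_subset
      \<comment> \<open>The zeros are placeholders, overwritten from index 1 upwards; index 0 keeps
        the conventional value.\<close>
      by (intro exI[of _ "\<lambda>_. 0"]) (auto simp: hurwitz_cylinder_0)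
  next
    fix b n assume b: "?P n b"
    then obtain c where c: "c \<in> gaussian_integers"
      "z \<in> closure (interior (hurwitz_cylinder (Suc n) (b(Suc n := c))))"
      using irrational_in_closure_of_child[of b z n] assms(2) by blast
    show "\<exists>b'. ?P (Suc n) b' \<and> (\<exists>c. b' = b(Suc n := c))"
      by (rule exI[of _ "b(Suc n := c)"]) (use b c in auto)
  qed
  then obtain f where f: "\<And>n. ?P n (f n)" "\<And>n. \<exists>c. f (Suc n) = (f n)(Suc n := c)"
    by blast
  have stable: "f (k + d) k = f k k" for k d
  proof (induction d)
    case (Suc d)
    then show ?case
      using f(2)[of "k + d"] by auto
  qed simp
  show ?thesis
  proof (rule that[of "\<lambda>k. f k k"])
    fix n
    have "hurwitz_cylinder n (\<lambda>k. f k k) = hurwitz_cylinder n (f n)"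
      by (rule hurwitz_cylinder_cong) (metis stable le_add_diff_inverse)
    then show "z \<in> closure (interior (hurwitz_cylinder n (\<lambda>k. f k k)))"
      using f(1)[of n] by simp
  qed (use f(1) in auto)
qed

theorem theorem1p1:
  shows "Lambda_bar ` R_bar = closure hurwitz_square - gaussian_rationals"
proof (intro equalityI subsetI)
  fix z assume "z \<in> Lambda_bar ` R_bar"
  then obtain a where a: "a \<in> R_bar" "z = Lambda_bar a"
    by blast
  have "hurwitz_cylinder n a \<noteq> {}" for n
  proof -
    \<comment> \<open>\<open>R_bar\<close> speaks only of n >= 1; passing to \<open>Suc n\<close>
      also covers the cylinder of order 0.\<close>
    have "interior (hurwitz_cylinder (Suc n) a) \<noteq> {}"
      using a(1) by (simp add: R_bar_def)
    then show ?thesis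
      using interior_subset hurwitz_cylinder_antimono[of n "Suc n" a] by fastforce
  qed
  then obtain s where s: "\<And>n. s n \<in> hurwitz_cylinder n a"
    unfolding ex_in_conv[symmetric] by metis
  then have "\<forall>n. s n \<in> hurwitz_square"
    by (auto simp: hurwitz_cylinder_def)
  then have "z \<in> closure hurwitz_square"
    using hurwitz_cylinder_points_tendsto[OF a(1) s] a(2) by (auto simp: closure_sequential)
  then show "z \<in> closure hurwitz_square - gaussian_rationals"
    using Lambda_bar_irrational[OF a(1) s] a(2) by simp
next
  fix z assume "z \<in> closure hurwitz_square - gaussian_rationals"
  then obtain a where a: "a 0 = 0" "\<And>k. a k \<in> gaussian_integers"
      "\<And>n. z \<in> closure (interior (hurwitz_cylinder n a))"
    using irrational_in_nested_closures by blast
  have "interior (hurwitz_cylinder n a) \<noteq> {}" for n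
    using a(3)[of n] by auto
  then have "a \<in> R_bar"
    using a(1,2) by (simp add: R_bar_def)
  have "z \<in> closure (hurwitz_cylinder n a)" for n
    using a(3)[of n] closure_mono[OF interior_subset] by blast
  \<comment> \<open>Although \<open>z\<close> itself may lie in none of the cylinders, points of
    them can be chosen converging to \<open>z\<close>, and any such choice converges to
    \<open>Lambda_bar a\<close>.\<close>
  then have "\<exists>x\<in>hurwitz_cylinder n a. dist x z < inverse (real (Suc n))" for n
    unfolding closure_approachable by simp
  then obtain s where s: "\<And>n. s n \<in> hurwitz_cylinder n a"
      "\<And>n. dist (s n) z < inverse (real (Suc n))"
    by metis
  have "s \<longlonglongrightarrow> z"
    unfolding tendsto_dist_iff[of s]
    by (rule Lim_null_comparison[OF _ LIMSEQ_inverse_real_of_nat])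
      (simp add: s(2) less_imp_le del: of_nat_Suc)
  then have "z = Lambda_bar a"
    using hurwitz_cylinder_points_tendsto[OF \<open>a \<in> R_bar\<close> s(1)] LIMSEQ_unique by blast
  then show "z \<in> Lambda_bar ` R_bar"
    using \<open>a \<in> R_bar\<close> by blast
qed

end
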